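(* Suppose the meta risk function $\ell$ satisfies: (1) $\ell(\mathfrak{D}_{\tau}^{Q},\mathfrak{D}_{\tau}^{S};\theta)$ is $\beta_\tau$-Lipschitz continuous with respect to $\theta$; (2) the cumulative distribution $F_{\ell}(l;\theta)$ is $\beta_{\ell}$-Lipschitz continuous with respect to $l$, and the normalized density function $p_{\alpha}(\tau;\theta)$ is $\beta_{\theta}$-Lipschitz continuous with respect to $\theta$; (3) for every $\theta\in\Theta$ and corresponding $p_\alpha(\tau;\theta)$, $\sup_{\tau\in\Omega_{\alpha,\tau}}\ell(\mathfrak{D}_{\tau}^{Q},\mathfrak{D}_{\tau}^{S};\theta)\le\mathcal{L}_{\max}$. Given a batch of tasks $\{\tau_i\}_{i=1}^{\mathcal{B}}$, let $\theta_T^{\mathrm{meta}}\in\Theta$ be the parameter learned after $T$ steps of the two-stage algorithm and let $\theta_*\in\Theta$ be the follower component of the converged equilibrium $(q_*,\theta_* )$. Then $$\mathrm{CVaR}_\alpha(\theta_T^{\mathrm{meta}})-\mathrm{CVaR}_\alpha(\theta_* )\le\beta_\tau\|\theta_T^{\mathrm{meta}}-\theta_*\|+\frac{\mathrm{VaR}_\alpha^*}{1-\alpha}\Big(\mathbb{P}(\mathcal{T}_1)-\mathbb{P}(\mathcal{T}_2)\Big),$$ where $\mathcal{T}_1=\{\tau:\ell^*<\mathrm{VaR}_\alpha^*,\ \ell^{\mathrm{meta}}\ge\mathrm{VaR}_\alpha^{\mathrm{meta}}\}$ and $\mathcal{T}_2=\{\tau:\ell^*\ge\mathrm{VaR}_\alpha^*,\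 \ell^{\mathrm{meta}}<\mathrm{VaR}_\alpha^{\mathrm{meta}}\}$.
   Context: $p(\tau)$ is the task distribution (density) on the task set $\mathcal{T}$, $\Theta$ (a subset of a Euclidean space) is the model parameter space, $\alpha\in[0,1)$, and $\mathbb{P}$ is probability under $p(\tau)$. Each task $\tau$ has a support set $\mathfrak{D}_\tau^S$ and query set $\mathfrak{D}_\tau^Q$; the meta risk function $\ell$ takes values in $\mathbb{R}^+$. $F_\ell(l;\theta):=\mathbb{P}(\ell(\mathfrak{D}_\tau^Q,\mathfrak{D}_\tau^S;\theta)\le l)$; $\mathrm{VaR}_\alpha[\ell(\mathcal{T},\theta)]:=\inf\{l\in\mathbb{R}^+:F_\ell(l;\theta)\ge\alpha\}$; $\Omega_{\alpha,\tau}=\{\tau:\ell(\mathfrak{D}_\tau^Q,\mathfrak{D}_\tau^S;\theta)\ge\mathrm{VaR}_\alpha[\ell(\mathcal{T},\theta)]\}$ is the tail risk task subspace; $p_\alpha(\tau;\theta)$ is the task distribution constrained to $\Omega_{\alpha,\tau}$ and normalized, i.e. $p(\tau)/(1-\alpha)$ on $\Omega_{\alpha,\tau}$ and $0$ elsewhere. $\mathrm{CVaR}_\alpha(\theta):=\mathbb{E}_{p_\alpha(\tau;\theta)}[\ell(\mathfrak{D}_\tau^Q,\mathfrak{D}_\tau^S;\theta)]$. Abbreviations: $\ell^*=\ell(\mathfrak{D}_\tau^Q,\mathfrak{D}_\tau^S;\theta_* )$, $\ell^{\mathrm{meta}}=\ell(\mathfrak{D}_\tau^Q,\mathfrak{D}_\tau^S;\theta_T^{\mathrm{meta}})$,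 $\mathrm{VaR}_\alpha^*=\mathrm{VaR}_\alpha[\ell(\mathcal{T},\theta_* )]$, $\mathrm{VaR}_\alpha^{\mathrm{meta}}=\mathrm{VaR}_\alpha[\ell(\mathcal{T},\theta_T^{\mathrm{meta}})]$. The two-stage algorithm alternates: given $\theta_t$, the leader picks $q_t\in\arg\max_{q\in\mathcal{Q}_\alpha}\mathbb{E}_q[\ell(\mathfrak{D}_\tau^Q,\mathfrak{D}_\tau^S;\theta_t)]$, then the follower updates $\theta_t$ to $\theta_{t+1}$ by minimizing (in practice by gradient steps) $\mathbb{E}_{q_t}[\ell(\mathfrak{D}_\tau^Q,\mathfrak{D}_\tau^S;\theta)]$ over $\theta$; here $\mathcal{Q}_\alpha$ is the set of normalized densities $p/(1-\alpha)$ restricted to task subspaces $\mathcal{T}_q\subseteq\mathcal{T}$ with $\int_{\mathcal{T}_q}p(\tau)d\tau=1-\alpha$. $(q_*,\theta_* )$ is the limit (Stackelberg equilibrium) of this sequence. *)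

theory Defs
  imports "HOL-Probability.Probability"
begin

text \<open>
  The task set is the space of a reference measure \<open>M\<close>; \<open>p\<close> is the task density with respect
  to \<open>M\<close>; \<open>L \<tau> \<theta>\<close> is the meta risk of task \<open>\<tau>\<close> at parameter \<open>\<theta>\<close>, that is
  \<open>risk(D\<^sup>Q\<^sub>\<tau>, D\<^sup>S\<^sub>\<tau>; \<theta>)\<close>.
  \<open>\<real>\<^sup>+\<close> is read as \<open>{0..}\<close>; the infimum in \<open>VaR\<close> is the same over \<open>{0<..}\<close>.
\<close>

definition task_distr :: "'a measure \<Rightarrow> ('a \<Rightarrow> real) \<Rightarrow> 'a measure" where
  "task_distr M p = density M (\<lambda>\<tau>. ennreal (p \<tau>))"

definition risk_cdf :: "'a measure \<Rightarrow> ('a \<Rightarrow> real) \<Rightarrow> ('a \<Rightarrow> 'b \<Rightarrow> real) \<Rightarrow> real \<Rightarrow> 'b \<Rightarrow> real" where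
  "risk_cdf M p L l \<theta> = measure (task_distr M p) {\<tau> \<in> space M. L \<tau> \<theta> \<le> l}"

definition VaR :: "'a measure \<Rightarrow> ('a \<Rightarrow> real) \<Rightarrow> ('a \<Rightarrow> 'b \<Rightarrow> real) \<Rightarrow> real \<Rightarrow> 'b \<Rightarrow> real" where
  "VaR M p L \<alpha> \<theta> = Inf {l. 0 \<le> l \<and> risk_cdf M p L l \<theta> \<ge> \<alpha>}"

definition tail_tasks :: "'a measure \<Rightarrow> ('a \<Rightarrow> real) \<Rightarrow> ('a \<Rightarrow> 'b \<Rightarrow> real) \<Rightarrow> real \<Rightarrow> 'b \<Rightarrow> 'a set" where
  "tail_tasks M p L \<alpha> \<theta> = {\<tau> \<in> space M. L \<tau> \<theta> \<ge> VaR M p L \<alpha> \<theta>}"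

text \<open>
  \<open>p / (1 - \<alpha>)\<close> on \<open>S\<close>; normalized exactly when \<open>S\<close> has task probability \<open>1 - \<alpha>\<close>.
\<close>

definition restricted_density :: "('a \<Rightarrow> real) \<Rightarrow> real \<Rightarrow> 'a set \<Rightarrow> 'a \<Rightarrow> real" where
  "restricted_density p \<alpha> S \<tau> = (if \<tau> \<in> S then p \<tau> / (1 - \<alpha>) else 0)"

definition tail_density ::
    "'a measure \<Rightarrow> ('a \<Rightarrow> real) \<Rightarrow> ('a \<Rightarrow> 'b \<Rightarrow> real) \<Rightarrow> real \<Rightarrow> 'a \<Rightarrow> 'b \<Rightarrow> real" where
  "tail_density M p L \<alpha> \<tau> \<theta> = restricted_density p \<alpha> (tail_tasks M p L \<alpha> \<theta>) \<tau>"

definition expect_density :: "'a measure \<Rightarrow> ('a \<Rightarrow> real) \<Rightarrow> ('a \<Rightarrow> real) \<Rightarrow> real" where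
  "expect_density M q f = (\<integral>\<tau>. q \<tau> * f \<tau> \<partial>M)"

definition CVaR :: "'a measure \<Rightarrow> ('a \<Rightarrow> real) \<Rightarrow> ('a \<Rightarrow> 'b \<Rightarrow> real) \<Rightarrow> real \<Rightarrow> 'b \<Rightarrow> real" where
  "CVaR M p L \<alpha> \<theta> = expect_density M (\<lambda>\<tau>. tail_density M p L \<alpha> \<tau> \<theta>) (\<lambda>\<tau>. L \<tau> \<theta>)"

definition leader_densities :: "'a measure \<Rightarrow> ('a \<Rightarrow> real) \<Rightarrow> real \<Rightarrow> ('a \<Rightarrow> real) set" where
  "leader_densities M p \<alpha> =
     {restricted_density p \<alpha> S | S. S \<in> sets M \<and> (LINT \<tau>:S|M. p \<tau>) = 1 - \<alpha>}"

definition leader_response ::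
    "'a measure \<Rightarrow> ('a \<Rightarrow> real) \<Rightarrow> ('a \<Rightarrow> 'b \<Rightarrow> real) \<Rightarrow> real \<Rightarrow> 'b \<Rightarrow> ('a \<Rightarrow> real) \<Rightarrow> bool" where
  "leader_response M p L \<alpha> \<theta> q \<longleftrightarrow>
     is_arg_max (\<lambda>q. expect_density M q (\<lambda>\<tau>. L \<tau> \<theta>)) (\<lambda>q. q \<in> leader_densities M p \<alpha>) q"

text \<open>
  The derivative is taken within \<open>\<Theta>\<close>, where alone the risk is constrained; at interior points of
  \<open>\<Theta>\<close> the vector \<open>g\<close> is the usual gradient.
\<close>

definition gradient_step ::
    "('b::euclidean_space \<Rightarrow> real) \<Rightarrow> 'b set \<Rightarrow> 'b \<Rightarrow> 'b \<Rightarrow> bool" where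
  "gradient_step J \<Theta> \<theta> \<theta>' \<longleftrightarrow> \<theta> \<in> \<Theta> \<and> \<theta>' \<in> \<Theta> \<and>
     (\<exists>g \<eta>. (J has_derivative (\<lambda>h. g \<bullet> h)) (at \<theta> within \<Theta>) \<and> 0 < \<eta> \<and> \<theta>' = \<theta> - \<eta> *\<^sub>R g)"

text \<open>
  The follower minimizes the expected risk under the leader's density, either exactly or by
  finitely many (at least one) gradient steps with arbitrary positive step sizes.
\<close>

definition follower_update ::
    "'a measure \<Rightarrow> ('a \<Rightarrow> 'b::euclidean_space \<Rightarrow> real) \<Rightarrow> 'b set \<Rightarrow> ('a \<Rightarrow> real) \<Rightarrow> 'b \<Rightarrow> 'b \<Rightarrow> bool" where
  "follower_update M L \<Theta> q \<theta> \<theta>' \<longleftrightarrow>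
     (let J = (\<lambda>\<theta>. expect_density M q (\<lambda>\<tau>. L \<tau> \<theta>))
      in is_arg_min J (\<lambda>\<theta>. \<theta> \<in> \<Theta>) \<theta>' \<or> (gradient_step J \<Theta>)\<^sup>+\<^sup>+ \<theta> \<theta>')"

definition two_stage_run ::
    "'a measure \<Rightarrow> ('a \<Rightarrow> real) \<Rightarrow> ('a \<Rightarrow> 'b::euclidean_space \<Rightarrow> real) \<Rightarrow> real \<Rightarrow> 'b set \<Rightarrow>
      (nat \<Rightarrow> 'a \<Rightarrow> real) \<Rightarrow> (nat \<Rightarrow> 'b) \<Rightarrow> bool" where
  "two_stage_run M p L \<alpha> \<Theta> q \<theta> \<longleftrightarrow> \<theta> 0 \<in> \<Theta> \<and>
     (\<forall>t. leader_response M p L \<alpha> (\<theta> t) (q t) \<and>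
          follower_update M L \<Theta> (q t) (\<theta> t) (\<theta> (Suc t)))"

text \<open>
  The equilibrium is the limit of the run: the parameters converge in the Euclidean space and the
  leader's densities converge in \<open>L\<^sup>1\<close> (total variation).
\<close>

definition converges_to_equilibrium ::
    "'a measure \<Rightarrow> ('a \<Rightarrow> real) \<Rightarrow> real \<Rightarrow> 'b::euclidean_space set \<Rightarrow>
      (nat \<Rightarrow> 'a \<Rightarrow> real) \<Rightarrow> (nat \<Rightarrow> 'b) \<Rightarrow> ('a \<Rightarrow> real) \<Rightarrow> 'b \<Rightarrow> bool" where
  "converges_to_equilibrium M p \<alpha> \<Theta> q \<theta> qs \<theta>s \<longleftrightarrow>
     qs \<in> leader_densities M p \<alpha> \<and> \<theta>s \<in> \<Theta> \<and>
     (\<lambda>t. \<integral>\<tau>. \<bar>q t \<tau> - qs \<tau>\<bar> \<partial>M) \<longlonglongrightarrow> 0 \<and> \<theta> \<longlonglongrightarrow> \<theta>s"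

end

theory Submission
  imports Defs
begin

text \<open>
  Pointwise in the task, the difference of the two tail-restricted risks is at most
  \<open>\<beta>\<^sub>\<tau> \<parallel>\<theta>\<^sub>m - \<theta>\<^sub>s\<parallel>\<close> on the part of the tail at \<open>\<theta>\<^sub>m\<close> where the risk is positive, plus
  \<open>VaR\<^sub>\<alpha>\<^sup>*\<close> times the difference of the indicators of \<open>\<T>\<^sub>1\<close> and \<open>\<T>\<^sub>2\<close>. Integrating, it remains to
  see that the first set has probability at most \<open>1 - \<alpha>\<close>. The whole tail may have a larger
  probability: the distribution function is continuous on \<open>[0, \<infinity>)\<close> only, so the risk may have an
  atom at \<open>0\<close>, and then \<open>VaR\<close> may be \<open>0\<close>. Tasks of zero risk at \<open>\<theta>\<^sub>m\<close> contribute nothing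
  positive to the difference, so discarding them is harmless.
\<close>

lemma sets_task_distr [simp, measurable_cong]: "sets (task_distr M p) = sets M"
  by (simp add: task_distr_def)

lemma space_task_distr [simp]: "space (task_distr M p) = space M"
  by (simp add: task_distr_def)

text \<open>The density \<open>p\<close> moves from the integrand into the measure, so that the
  later estimates take place under a probability measure. The equation needs no integrability, since
  both sides then take the default value of the integral together.\<close>

lemma CVaR_eq_task_distr:
  assumes p: "p \<in> borel_measurable M" "\<And>\<tau>. \<tau> \<in> space M \<Longrightarrow> 0 \<le> p \<tau>"
    and L: "(\<lambda>\<tau>. L \<tau> \<theta>) \<in> borel_measurable M"
  shows "CVaR M p L \<alpha> \<theta> =
    (\<integral>\<tau>. indicator (tail_tasks M p L \<alpha> \<theta>) \<tau> * L \<tau> \<theta> \<partial>task_distr M p) / (1 - \<alpha>)"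
proof -
  let ?A = "tail_tasks M p L \<alpha> \<theta>"
  have A [measurable]: "?A \<in> sets M"
    unfolding tail_tasks_def using L by measurable
  have "(\<integral>\<tau>. indicator ?A \<tau> * L \<tau> \<theta> \<partial>task_distr M p) =
      (\<integral>\<tau>. p \<tau> *\<^sub>R (indicator ?A \<tau> * L \<tau> \<theta>) \<partial>M)"
    unfolding task_distr_def using p L by (intro integral_density) auto
  also have "\<dots> / (1 - \<alpha>) = (\<integral>\<tau>. p \<tau> *\<^sub>R (indicator ?A \<tau> * L \<tau> \<theta>) / (1 - \<alpha>) \<partial>M)"
    by simp
  also have "\<dots> = CVaR M p L \<alpha> \<theta>"
    unfolding CVaR_def expect_density_def tail_density_def restricted_density_def
    by (intro Bochner_Integration.integral_cong) (auto simp: indicator_def)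
  finally show ?thesis by simp
qed

text \<open>For fixed \<theta>, \<open>risk_cdf\<close> is the distribution function of the law of
  the risk under the task distribution.\<close>

lemma risk_cdf_tendsto_1:
  assumes "prob_space (task_distr M p)"
    and L: "(\<lambda>\<tau>. L \<tau> \<theta>) \<in> borel_measurable M"
  shows "((\<lambda>l. risk_cdf M p L l \<theta>) \<longlongrightarrow> 1) at_top"
proof -
  interpret P: prob_space "task_distr M p" by fact
  have X [measurable]: "(\<lambda>\<tau>. L \<tau> \<theta>) \<in> borel_measurable (task_distr M p)"
    using L by (simp add: task_distr_def)
  interpret D: real_distribution "distr (task_distr M p) borel (\<lambda>\<tau>. L \<tau> \<theta>)"
    by (rule P.real_distribution_distr) measurable
  have "cdf (distr (task_distr M p) borel (\<lambda>\<tau>. L \<tau> \<theta>)) = (\<lambda>l. risk_cdf M p L l \<theta>)"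
    unfolding fun_eq_iff cdf_def risk_cdf_def
    by (subst measure_distr) (auto simp: vimage_def Int_def intro!: arg_cong[where f = "measure _"])
  then show ?thesis
    using D.cdf_lim_at_top_prob by simp
qed

text \<open>The set under the infimum is nonempty because the distribution function tends to 1 >
  \<alpha>, closed as the preimage of a closed ray under a function continuous on a closed
  half-line, and bounded below by 0. So it contains its infimum.\<close>

lemma VaR_attained:
  assumes P: "prob_space (task_distr M p)" and \<alpha>: "\<alpha> < 1"
    and L: "(\<lambda>\<tau>. L \<tau> \<theta>) \<in> borel_measurable M"
    and cont: "continuous_on {0..} (\<lambda>l. risk_cdf M p L l \<theta>)"
  shows "0 \<le> VaR M p L \<alpha> \<theta>" "\<alpha> \<le> risk_cdf M p L (VaR M p L \<alpha> \<theta>) \<theta>"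
proof -
  let ?S = "{l. 0 \<le> l \<and> \<alpha> \<le> risk_cdf M p L l \<theta>}"
  have "\<forall>\<^sub>F l in at_top. \<alpha> < risk_cdf M p L l \<theta>"
    using risk_cdf_tendsto_1[where L = L, OF P L] \<alpha> by (rule order_tendstoD(1))
  then have "\<forall>\<^sub>F l in at_top. l \<in> ?S"
    using eventually_ge_at_top[of 0] by eventually_elim simp
  then have "?S \<noteq> {}"
    by (auto dest!: eventually_happens)
  moreover have "closed ((\<lambda>l. risk_cdf M p L l \<theta>) -` {\<alpha>..} \<inter> {0..})"
    using cont by (intro continuous_on_closed_vimage[THEN iffD1, rule_format]) auto
  then have "closed ?S"
    by (simp add: vimage_def Int_def conj_commute)
  ultimately have "VaR M p L \<alpha> \<theta> \<in> ?S"
    unfolding VaR_def by (intro closed_contains_Inf) (auto intro!: bdd_belowI[of _ 0])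
  then show "0 \<le> VaR M p L \<alpha> \<theta>" "\<alpha> \<le> risk_cdf M p L (VaR M p L \<alpha> \<theta>) \<theta>"
    by auto
qed

text \<open>The complement \<open>?C\<close> has probability at least \<alpha>, because it is at
  least the value of the distribution function at \<open>?v\<close>, which is at least \<alpha> by
  \<open>VaR_attained\<close>.\<close>

lemma prob_positive_tail_le:
  assumes P: "prob_space (task_distr M p)" and \<alpha>: "\<alpha> < 1"
    and L: "(\<lambda>\<tau>. L \<tau> \<theta>) \<in> borel_measurable M"
    and cont: "continuous_on {0..} (\<lambda>l. risk_cdf M p L l \<theta>)"
  shows "measure (task_distr M p) {\<tau> \<in> tail_tasks M p L \<alpha> \<theta>. 0 < L \<tau> \<theta>} \<le> 1 - \<alpha>"
proof -
  interpret P: prob_space "task_distr M p" by fact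
  let ?v = "VaR M p L \<alpha> \<theta>" and ?F = "\<lambda>l. risk_cdf M p L l \<theta>"
  let ?C = "{\<tau> \<in> space M. L \<tau> \<theta> < ?v \<or> L \<tau> \<theta> \<le> 0}"
  have C: "?C \<in> sets M"
    using L by measurable
  note v = VaR_attained[where L = L, OF P \<alpha> L cont]
  \<comment> \<open>The two alternatives serve the two cases below: levels under \<open>?v\<close>
    approximate a positive \<open>?v\<close> from the left, and level 0 is \<open>?v\<close> itself
    when there may be an atom.\<close>
  have le: "?F l \<le> P.prob ?C" if "l < ?v \<or> l = 0" for l
    unfolding risk_cdf_def using that C by (intro P.finite_measure_mono) auto
  have "?F ?v \<le> P.prob ?C"
  proof (cases "?v = 0")
    case False
    with v have pos: "0 < ?v" by simp
    \<comment> \<open>A positive \<open>?v\<close> is interior to the half-line, so continuity there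
      is two-sided and \<open>?F ?v\<close> is a left limit.\<close>
    have "isCont ?F ?v"
      using cont pos continuous_on_interior[of "{0..}" ?F ?v] by simp
    then have "(?F \<longlongrightarrow> ?F ?v) (at_left ?v)"
      by (simp add: isCont_def filterlim_at_split)
    then show ?thesis
      by (rule tendsto_upperbound) (auto simp: eventually_at_filter intro!: always_eventually le)
  next
    case True
    then show ?thesis using le[of ?v] by blast
  qed
  with v have "\<alpha> \<le> P.prob ?C" by simp
  moreover have "{\<tau> \<in> tail_tasks M p L \<alpha> \<theta>. 0 < L \<tau> \<theta>} = space (task_distr M p) - ?C"
    by (auto simp: tail_tasks_def)
  ultimately show ?thesis
    using P.prob_compl[of ?C] C by simp
qed

lemma CVaR_diff_le:
  assumes p: "p \<in> borel_measurable M" "\<And>\<tau>. \<tau> \<in> space M \<Longrightarrow> 0 \<le> p \<tau>"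
    and P: "prob_space (task_distr M p)" and \<alpha>: "\<alpha> < 1"
    and L: "(\<lambda>\<tau>. L \<tau> \<theta>) \<in> borel_measurable M" "(\<lambda>\<tau>. L \<tau> \<theta>') \<in> borel_measurable M"
    and int: "integrable (task_distr M p) (\<lambda>\<tau>. L \<tau> \<theta>)" "integrable (task_distr M p) (\<lambda>\<tau>. L \<tau> \<theta>')"
    and nonneg: "\<And>\<tau>. \<tau> \<in> space M \<Longrightarrow> 0 \<le> L \<tau> \<theta>" "\<And>\<tau>. \<tau> \<in> space M \<Longrightarrow> 0 \<le> L \<tau> \<theta>'"
    and cont: "continuous_on {0..} (\<lambda>l. risk_cdf M p L l \<theta>)"
    and diff: "\<And>\<tau>. \<tau> \<in> space M \<Longrightarrow> L \<tau> \<theta> - L \<tau> \<theta>' \<le> c" and c: "0 \<le> c"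
  shows "CVaR M p L \<alpha> \<theta> - CVaR M p L \<alpha> \<theta>' \<le> c + VaR M p L \<alpha> \<theta>' / (1 - \<alpha>) *
    (measure (task_distr M p)
       {\<tau> \<in> space M. L \<tau> \<theta>' < VaR M p L \<alpha> \<theta>' \<and> VaR M p L \<alpha> \<theta> \<le> L \<tau> \<theta>}
     - measure (task_distr M p)
       {\<tau> \<in> space M. VaR M p L \<alpha> \<theta>' \<le> L \<tau> \<theta>' \<and> L \<tau> \<theta> < VaR M p L \<alpha> \<theta>})"
proof -
  interpret P: prob_space "task_distr M p" by fact
  let ?A = "tail_tasks M p L \<alpha> \<theta>" and ?A' = "tail_tasks M p L \<alpha> \<theta>'"
  let ?v = "VaR M p L \<alpha> \<theta>" and ?v' = "VaR M p L \<alpha> \<theta>'"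
  let ?B = "{\<tau> \<in> ?A. 0 < L \<tau> \<theta>}"
  let ?T1 = "{\<tau> \<in> space M. L \<tau> \<theta>' < ?v' \<and> ?v \<le> L \<tau> \<theta>}"
  let ?T2 = "{\<tau> \<in> space M. ?v' \<le> L \<tau> \<theta>' \<and> L \<tau> \<theta> < ?v}"
  note [measurable] = L
  have T: "?T1 \<in> sets M" "?T2 \<in> sets M"
    by measurable
  have A: "?A \<in> sets M" "?A' \<in> sets M"
    unfolding tail_tasks_def by measurable
  have B: "?B \<in> sets M"
    unfolding tail_tasks_def by measurable
  have int': "integrable (task_distr M p) (\<lambda>\<tau>. indicator ?A \<tau> * L \<tau> \<theta>)"
    "integrable (task_distr M p) (\<lambda>\<tau>. indicator ?A' \<tau> * L \<tau> \<theta>')"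
    using integrable_mult_indicator[OF _ int(1), of ?A]
      integrable_mult_indicator[OF _ int(2), of ?A'] A by simp_all
  have ind: "integrable (task_distr M p) (indicator S :: _ \<Rightarrow> real)" if "S \<in> sets M" for S
    using that by (simp add: P.emeasure_finite top.not_eq_extremum[symmetric])
  have "(\<integral>\<tau>. indicator ?A \<tau> * L \<tau> \<theta> \<partial>task_distr M p) -
      (\<integral>\<tau>. indicator ?A' \<tau> * L \<tau> \<theta>' \<partial>task_distr M p) =
      (\<integral>\<tau>. indicator ?A \<tau> * L \<tau> \<theta> - indicator ?A' \<tau> * L \<tau> \<theta>' \<partial>task_distr M p)"
    using int' by simp
  also have "\<dots> \<le> (\<integral>\<tau>. c * indicator ?B \<tau> + ?v' * (indicator ?T1 \<tau> - indicator ?T2 \<tau>)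
      \<partial>task_distr M p)"
  proof (rule integral_mono)
    fix \<tau> assume "\<tau> \<in> space (task_distr M p)"
    then have \<tau>: "\<tau> \<in> space M" by simp
    \<comment> \<open>Four cases. In both tails, the bound is \<open>diff\<close> if the risk at
      \<theta> is positive, and otherwise the left side is at most 0. In \<open>?A\<close> only,
      \<tau> lies in \<open>?T1\<close> and \<open>L \<tau> \<theta>' < ?v'\<close>, so
      \<open>?v'\<close> is positive and covers zero risk as well. In \<open>?A'\<close> only,
      \<tau> lies in \<open>?T2\<close> and \<open>L \<tau> \<theta>'\<close> is at least
      \<open>?v'\<close>. In neither tail, both sides vanish.\<close>
    show "indicator ?A \<tau> * L \<tau> \<theta> - indicator ?A' \<tau> * L \<tau> \<theta>' \<le>
        c * indicator ?B \<tau> + ?v' * (indicator ?T1 \<tau> - indicator ?T2 \<tau>)"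
      using nonneg[OF \<tau>] diff[OF \<tau>] c \<tau>
      by (auto simp: indicator_def tail_tasks_def not_less not_le)
  qed (intro Bochner_Integration.integrable_add Bochner_Integration.integrable_diff int'
      integrable_mult_right ind B T)+
  also have "\<dots> = c * P.prob ?B + ?v' * (P.prob ?T1 - P.prob ?T2)"
    using ind[OF B] ind[OF T(1)] ind[OF T(2)] T[THEN sets.sets_into_space]
      B[THEN sets.sets_into_space]
    by (simp add: Int_absorb2)
  \<comment> \<open>This factor cancels the normalization of \<open>CVaR\<close>, which leaves
    \<open>c\<close> with coefficient exactly 1.\<close>
  also have "\<dots> \<le> c * (1 - \<alpha>) + ?v' * (P.prob ?T1 - P.prob ?T2)"
    using prob_positive_tail_le[where L = L, OF P \<alpha> L(1) cont] c by (simp add: mult_left_mono)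
  finally have "(1 - \<alpha>) * CVaR M p L \<alpha> \<theta> - (1 - \<alpha>) * CVaR M p L \<alpha> \<theta>' \<le>
      c * (1 - \<alpha>) + ?v' * (P.prob ?T1 - P.prob ?T2)"
    using CVaR_eq_task_distr[where L = L and \<alpha> = \<alpha>, OF p L(1)]
      CVaR_eq_task_distr[where L = L and \<alpha> = \<alpha>, OF p L(2)] \<alpha> by simp
  then show ?thesis
    using \<alpha> by (simp add: field_simps)
qed

text \<open>Off the tail the risk is below \<open>VaR\<close>, on the tail it is at most
  \<open>K\<close>; a bounded function is integrable under a probability measure. The supremum is
  taken in \<open>ereal\<close> because over an unbounded set a real one would be an unspecified
  number.\<close>

lemma integrable_of_tail_bounded:
  assumes P: "prob_space (task_distr M p)"
    and L: "(\<lambda>\<tau>. L \<tau> \<theta>) \<in> borel_measurable M"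
    and nonneg: "\<And>\<tau>. \<tau> \<in> space M \<Longrightarrow> 0 \<le> L \<tau> \<theta>"
    and bound: "(SUP \<tau> \<in> tail_tasks M p L \<alpha> \<theta>. ereal (L \<tau> \<theta>)) \<le> ereal K"
  shows "integrable (task_distr M p) (\<lambda>\<tau>. L \<tau> \<theta>)"
proof -
  interpret P: prob_space "task_distr M p" by fact
  have "\<bar>L \<tau> \<theta>\<bar> \<le> max K (VaR M p L \<alpha> \<theta>)" if "\<tau> \<in> space M" for \<tau>
  proof (cases "\<tau> \<in> tail_tasks M p L \<alpha> \<theta>")
    case True
    then have "L \<tau> \<theta> \<le> K"
      using bound by (simp add: SUP_le_iff)
    then show ?thesis using nonneg[OF that] by simp
  qed (use nonneg[OF that] that in \<open>auto simp: tail_tasks_def\<close>)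
  then show ?thesis
    using L by (intro P.integrable_const_bound[where B = "max K (VaR M p L \<alpha> \<theta>)"]) auto
qed

lemma two_stage_run_in_params:
  assumes "two_stage_run M p L \<alpha> \<Theta> q \<theta>"
  shows "\<theta> t \<in> \<Theta>"
proof (cases t)
  case 0
  then show ?thesis using assms by (simp add: two_stage_run_def)
next
  case (Suc n)
  have "follower_update M L \<Theta> (q n) (\<theta> n) (\<theta> (Suc n))"
    using assms by (simp add: two_stage_run_def)
  \<comment> \<open>An exact minimizer lies in \<Theta> by definition. For a chain of gradient
    steps, \<open>tranclp.cases\<close> exposes the last step, whose endpoint lies in
    \<Theta>.\<close>
  then show ?thesis
    unfolding Suc follower_update_def Let_def
    by (auto simp: is_arg_min_def gradient_step_def elim: tranclp.cases)
qed

theorem theorem4p2: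
  fixes M :: "'a measure" and p :: "'a \<Rightarrow> real"
    and DQ DS :: "'a \<Rightarrow> 'd" and risk :: "'d \<Rightarrow> 'd \<Rightarrow> 'b::euclidean_space \<Rightarrow> real"
    and L :: "'a \<Rightarrow> 'b \<Rightarrow> real"
    and \<Theta> :: "'b set" and \<alpha> \<beta>\<^sub>\<tau> \<beta>\<^sub>l \<beta>\<^sub>\<theta> L\<^sub>m\<^sub>a\<^sub>x :: real
    and B :: nat and task :: "nat \<Rightarrow> 'a"
    and q :: "nat \<Rightarrow> 'a \<Rightarrow> real" and \<theta> :: "nat \<Rightarrow> 'b"
    and q\<^sub>s :: "'a \<Rightarrow> real" and \<theta>\<^sub>s \<theta>\<^sub>m :: 'b and T :: nat
  assumes p_meas: "p \<in> borel_measurable M"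
    and p_nonneg: "\<And>\<tau>. \<tau> \<in> space M \<Longrightarrow> 0 \<le> p \<tau>"
    and p_prob: "prob_space (task_distr M p)"
    and alpha: "0 \<le> \<alpha>" "\<alpha> < 1"
    and L_eq: "\<And>\<tau> \<theta>. L \<tau> \<theta> = risk (DQ \<tau>) (DS \<tau>) \<theta>"
    and L_meas: "\<And>\<theta>. \<theta> \<in> \<Theta> \<Longrightarrow> (\<lambda>\<tau>. L \<tau> \<theta>) \<in> borel_measurable M"
    and L_nonneg: "\<And>\<tau> \<theta>. \<tau> \<in> space M \<Longrightarrow> \<theta> \<in> \<Theta> \<Longrightarrow> 0 \<le> L \<tau> \<theta>"
    and L_lipschitz: "\<And>\<tau>. \<tau> \<in> space M \<Longrightarrow> \<beta>\<^sub>\<tau>-lipschitz_on \<Theta> (\<lambda>\<theta>. L \<tau> \<theta>)"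
    and cdf_lipschitz: "\<And>\<theta>. \<theta> \<in> \<Theta> \<Longrightarrow> \<beta>\<^sub>l-lipschitz_on {0..} (\<lambda>l. risk_cdf M p L l \<theta>)"
    and density_lipschitz:
      "\<And>\<tau>. \<tau> \<in> space M \<Longrightarrow> \<beta>\<^sub>\<theta>-lipschitz_on \<Theta> (\<lambda>\<theta>. tail_density M p L \<alpha> \<tau> \<theta>)"
    and tail_bounded:
      "\<And>\<theta>. \<theta> \<in> \<Theta> \<Longrightarrow> (SUP \<tau> \<in> tail_tasks M p L \<alpha> \<theta>. ereal (L \<tau> \<theta>)) \<le> ereal L\<^sub>m\<^sub>a\<^sub>x"
    and batch: "\<And>i. i \<in> {1..B} \<Longrightarrow> task i \<in> space M"
    and run: "two_stage_run M p L \<alpha> \<Theta> q \<theta>"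
    and theta_meta: "\<theta>\<^sub>m = \<theta> T"
    and equilibrium: "converges_to_equilibrium M p \<alpha> \<Theta> q \<theta> q\<^sub>s \<theta>\<^sub>s"
  shows "CVaR M p L \<alpha> \<theta>\<^sub>m - CVaR M p L \<alpha> \<theta>\<^sub>s
    \<le> \<beta>\<^sub>\<tau> * norm (\<theta>\<^sub>m - \<theta>\<^sub>s)
      + VaR M p L \<alpha> \<theta>\<^sub>s / (1 - \<alpha>) *
        (measure (task_distr M p)
           {\<tau> \<in> space M. L \<tau> \<theta>\<^sub>s < VaR M p L \<alpha> \<theta>\<^sub>s \<and> L \<tau> \<theta>\<^sub>m \<ge> VaR M p L \<alpha> \<theta>\<^sub>m}
         - measure (task_distr M p)
           {\<tau> \<in> space M. L \<tau> \<theta>\<^sub>s \<ge> VaR M p L \<alpha> \<theta>\<^sub>s \<and> L \<tau> \<theta>\<^sub>m < VaR M p L \<alpha> \<theta>\<^sub>m})"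
proof -
  interpret P: prob_space "task_distr M p" by fact
  have m: "\<theta>\<^sub>m \<in> \<Theta>"
    unfolding theta_meta using run by (rule two_stage_run_in_params)
  have s: "\<theta>\<^sub>s \<in> \<Theta>"
    using equilibrium by (simp add: converges_to_equilibrium_def)
  have diff: "L \<tau> \<theta>\<^sub>m - L \<tau> \<theta>\<^sub>s \<le> \<beta>\<^sub>\<tau> * norm (\<theta>\<^sub>m - \<theta>\<^sub>s)" if "\<tau> \<in> space M" for \<tau>
    using lipschitz_onD[OF L_lipschitz[OF that] m s] by (simp add: dist_norm)
  \<comment> \<open>The sign is part of \<open>lipschitz_on\<close>, which is available only at some
    task; a probability space has one.\<close>
  have "0 \<le> \<beta>\<^sub>\<tau>"
    using P.not_empty L_lipschitz lipschitz_on_nonneg by fastforce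
  then show ?thesis
    using p_meas p_nonneg p_prob alpha L_meas[OF m] L_meas[OF s] L_nonneg[OF _ m] L_nonneg[OF _ s]
      integrable_of_tail_bounded[where L = L, OF p_prob L_meas[OF m] L_nonneg[OF _ m] tail_bounded[OF m]]
      integrable_of_tail_bounded[where L = L, OF p_prob L_meas[OF s] L_nonneg[OF _ s] tail_bounded[OF s]]
      lipschitz_on_continuous_on[OF cdf_lipschitz[OF m]] diff
    by (intro CVaR_diff_le) auto
qed

end
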